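(* Let $(X,\rho)$ be an ultrametric space with $2\leqslant\operatorname{card}X<\infty$ and let $G$ be a graph such that $V(G)=X$ and, for all distinct $u,v\in X$, $\{u,v\}\in E(G)$ if and only if $\{u,v\}$ is a $\rho$-diametrical pair of points for $X$. Then $G$ is a complete $k$-partite graph with some $k\geqslant 2$. Conversely, if $G=(V,E)$ is a finite ($\operatorname{card}V<\infty$) complete $k$-partite graph with $k\geqslant 2$, then there is an ultrametric $\rho:V\times V\rightarrow\mathbb{R}^+$ such that $E$ is the set of $\rho$-diametrical pairs of points for $V$.
   Context: $\mathbb{R}^+=[0,\infty)$. An ultrametric on a set $X$ is a metric $\rho:X\times X\to\mathbb{R}^+$ satisfying $\rho(x,y)\leqslant\max\{\rho(x,z),\rho(z,y)\}$ for all $x,y,z\in X$. For $A\subseteq X$, $\operatorname{diam}A=\sup\{\rho(x,y):x,y\in A\}$. A two-element subset $\{a,b\}$ of $A$ is a $\rho$-diametrical pair for $A$ if $\rho(a,b)=\operatorname{diam}A$. All graphs are simple: a graph $G=(V,E)$ has a vertex set $V=V(G)$ and an edge set $E=E(G)$ consisting of two-element subsets of $V$. A graph $G$ is $k$-partite if $V(G)$ can be partitioned into $k$ nonempty disjoint parts such that no edge has both ends in the same part; a $k$-partite graph is complete if any two vertices in different parts are adjacent. *)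

theory Defs
  imports "HOL-Analysis.Analysis" "HOL-Library.Disjoint_Sets"
begin

(* Following the library's Metric_space, a metric on M is a total function whose values off M
   are irrelevant except that they are nonnegative and symmetric. Every metric on M extends to such
   a function, for instance by 0, so this is no restriction. *)
locale Ultrametric_space = Metric_space M d for M :: "'a set" and d :: "'a \<Rightarrow> 'a \<Rightarrow> real" +
  assumes ultra: "\<And>x y z. \<lbrakk>x \<in> M; y \<in> M; z \<in> M\<rbrakk> \<Longrightarrow> d x y \<le> max (d x z) (d z y)"

(* The counterpart of the library's type-class based diameter for an arbitrary distance
   function. For unbounded A the real supremum is unspecified. *)
definition mdiam :: "('a \<Rightarrow> 'a \<Rightarrow> real) \<Rightarrow> 'a set \<Rightarrow> real" where
  "mdiam d A = (if A = {} then 0 else SUP (x, y) \<in> A \<times> A. d x y)"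

definition diametrical_pair :: "('a \<Rightarrow> 'a \<Rightarrow> real) \<Rightarrow> 'a set \<Rightarrow> 'a set \<Rightarrow> bool" where
  "diametrical_pair d A p \<longleftrightarrow>
     (\<exists>a b. p = {a, b} \<and> a \<noteq> b \<and> a \<in> A \<and> b \<in> A \<and> d a b = mdiam d A)"

definition simple_graph :: "'a set \<Rightarrow> 'a set set \<Rightarrow> bool" where
  "simple_graph V E \<longleftrightarrow> (\<forall>e\<in>E. e \<subseteq> V \<and> card e = 2)"

definition partite_parts :: "nat \<Rightarrow> 'a set \<Rightarrow> 'a set set \<Rightarrow> 'a set set \<Rightarrow> bool" where
  "partite_parts k V E P \<longleftrightarrow>
     partition_on V P \<and> finite P \<and> card P = k \<and>
     (\<forall>A\<in>P. \<forall>u\<in>A. \<forall>v\<in>A. {u, v} \<notin> E)"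

definition complete_partite :: "nat \<Rightarrow> 'a set \<Rightarrow> 'a set set \<Rightarrow> bool" where
  "complete_partite k V E \<longleftrightarrow>
     simple_graph V E \<and>
     (\<exists>P. partite_parts k V E P \<and>
          (\<forall>A\<in>P. \<forall>B\<in>P. A \<noteq> B \<longrightarrow> (\<forall>u\<in>A. \<forall>v\<in>B. {u, v} \<in> E)))"

end

theory Submission
  imports Defs
begin

text \<open>In a finite ultrametric space of diameter \<open>D > 0\<close>, the relation \<open>d u v < D\<close> is an equivalence
  by the strong triangle inequality. Diametrical pairs are exactly the pairs of inequivalent points,
  so the equivalence classes are the parts. Conversely, on a complete multipartite graph give
  adjacent vertices distance 2 and distinct nonadjacent vertices distance 1: non-adjacency is
  transitive, which is the strong triangle inequality.\<close>

lemma mdiam_eqI: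
  assumes "a \<in> A" "b \<in> A" and "\<And>x y. x \<in> A \<Longrightarrow> y \<in> A \<Longrightarrow> d x y \<le> d a b"
  shows "mdiam d A = d a b"
proof -
  have "(SUP (x, y) \<in> A \<times> A. d x y) = d a b"
    using assms by (intro cSup_eq_maximum) force+
  then show ?thesis
    using assms(1) by (auto simp: mdiam_def)
qed

text \<open>Over a finite nonempty set the supremum is a maximum. The pair attaining it later
  supplies two points in different parts.\<close>

lemma mdiam_attained:
  assumes "finite A" "A \<noteq> {}"
  obtains a b where "a \<in> A" "b \<in> A" "mdiam d A = d a b"
    and "\<And>x y. x \<in> A \<Longrightarrow> y \<in> A \<Longrightarrow> d x y \<le> mdiam d A"
proof -
  let ?S = "(\<lambda>(x, y). d x y) ` (A \<times> A)"
  have S: "finite ?S" "?S \<noteq> {}"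
    using assms by auto
  obtain a b where ab: "a \<in> A" "b \<in> A" "Max ?S = d a b"
    using Max_in[OF S] by auto
  have le: "d x y \<le> d a b" if "x \<in> A" "y \<in> A" for x y
    unfolding ab(3)[symmetric] using that by (intro Max_ge[OF S(1)]) auto
  have "mdiam d A = d a b"
    using ab(1,2) le by (rule mdiam_eqI)
  with that[OF ab(1,2)] le show thesis
    by simp
qed

text \<open>An unordered pair may be presented in either order, so symmetry of \<open>d\<close> is
  what lets the existential witnesses be replaced by \<open>u\<close> and \<open>v\<close>.\<close>

lemma (in Metric_space) diametrical_pair_iff:
  "diametrical_pair d A {u, v} \<longleftrightarrow> u \<noteq> v \<and> u \<in> A \<and> v \<in> A \<and> d u v = mdiam d A"
  using commute[of u v] by (auto simp: diametrical_pair_def doubleton_eq_iff)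

lemma simple_graph_no_loop: "simple_graph V E \<Longrightarrow> {v, v} \<notin> E"
  by (force simp: simple_graph_def)

text \<open>Reflexivity comes from \<open>d x x = 0 < r\<close>. The classes are the open balls of
  radius \<open>r\<close>, which in an ultrametric space are equal or disjoint.\<close>

lemma (in Ultrametric_space) equiv_dist_less:
  assumes "0 < r"
  shows "equiv M {(u, v). u \<in> M \<and> v \<in> M \<and> d u v < r}"
proof (rule equivI)
  show "trans {(u, v). u \<in> M \<and> v \<in> M \<and> d u v < r}"
  proof (rule transI, clarsimp)
    fix x y z assume "x \<in> M" "y \<in> M" "z \<in> M" "d x y < r" "d y z < r"
    then show "d x z < r"
      using ultra[of x z y] by linarith
  qed
qed (use assms in \<open>auto simp: refl_on_def sym_def commute\<close>)

lemma (in Ultrametric_space) diametrical_graph_complete_partite: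
  assumes fin: "finite M" and card: "2 \<le> card M" and sg: "simple_graph M E"
    and E: "\<And>u v. u \<in> M \<Longrightarrow> v \<in> M \<Longrightarrow> u \<noteq> v \<Longrightarrow> {u, v} \<in> E \<longleftrightarrow> diametrical_pair d M {u, v}"
  shows "\<exists>k\<ge>2. complete_partite k M E"
proof -
  define D where "D = mdiam d M"
  have "M \<noteq> {}" using card by auto
  then obtain a b where ab: "a \<in> M" "b \<in> M" "D = d a b"
    and le: "\<And>x y. x \<in> M \<Longrightarrow> y \<in> M \<Longrightarrow> d x y \<le> D"
    using mdiam_attained[OF fin] unfolding D_def by metis
  obtain x y where "x \<in> M" "y \<in> M" "x \<noteq> y"
    using card by (metis card_le_Suc0_iff_eq fin not_less_eq_eq numeral_2_eq_2)
  \<comment> \<open>Two distinct points force a positive diameter; this makes \<open>R\<close> below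
    reflexive and keeps the pair attaining \<open>D\<close> from being a single point.\<close>
  then have "0 < D" using le[of x y] mdist_pos_less[of x y] by linarith
  define R where "R = {(u, v). u \<in> M \<and> v \<in> M \<and> d u v < D}"
  have eq: "equiv M R"
    unfolding R_def using \<open>0 < D\<close> by (rule equiv_dist_less)
  define P where "P = M // R"
  \<comment> \<open>For \<open>u = v\<close> both sides fail, as there are no loops and
    \<open>d u u = 0 < D\<close>. For distinct points \<open>d u v\<close> is at most
    \<open>D\<close>, so it equals \<open>D\<close> unless it is smaller.\<close>
  have edge: "{u, v} \<in> E \<longleftrightarrow> (u, v) \<notin> R" if "u \<in> M" "v \<in> M" for u v
  proof (cases "u = v")
    case True
    then show ?thesis
      using simple_graph_no_loop[OF sg] that \<open>0 < D\<close> by (auto simp: R_def)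
  next
    case False
    then show ?thesis
      using E[OF that False] that le[OF that] by (auto simp: diametrical_pair_iff R_def D_def)
  qed
  have part: "partition_on M P"
    unfolding P_def by (rule partition_on_quotient[OF eq])
  have finP: "finite P"
    using finite_elements[OF fin part] .
  \<comment> \<open>The points \<open>a\<close> and \<open>b\<close> at distance \<open>D\<close>
    are not related, so their classes differ and there are at least two parts.\<close>
  have "{R `` {a}, R `` {b}} \<subseteq> P"
    using ab by (auto simp: P_def intro: quotientI)
  moreover have "R `` {a} \<noteq> R `` {b}"
    using eq_equiv_class[OF _ eq, of a b] ab by (auto simp: R_def)
  ultimately have "2 \<le> card P"
    using card_mono[OF finP, of "{R `` {a}, R `` {b}}"] by simp
  moreover have "{u, v} \<notin> E" if "A \<in> P" "u \<in> A" "v \<in> A" for A u v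
  proof -
    have "(u, v) \<in> R" "A \<subseteq> M"
      using that in_quotient_imp_in_rel[OF eq, of A u v] in_quotient_imp_subset[OF eq, of A]
      by (simp_all add: P_def)
    then show ?thesis
      using edge[of u v] that by blast
  qed
  moreover have "{u, v} \<in> E" if "A \<in> P" "B \<in> P" "A \<noteq> B" "u \<in> A" "v \<in> B" for A B u v
  proof -
    have "(u, v) \<notin> R" "A \<subseteq> M" "B \<subseteq> M"
      using that quotient_eqI[OF eq, of A B u v] in_quotient_imp_subset[OF eq]
      unfolding P_def by blast+
    then show ?thesis
      using edge[of u v] that by blast
  qed
  ultimately show ?thesis
    unfolding complete_partite_def partite_parts_def using sg part finP
    by (intro exI[of _ "card P"] exI[of _ P] conjI) auto
qed

text \<open>The ends of an edge lie in different parts, so the part of \<open>z\<close> differs from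
  at least one of theirs. This is transitivity of non-adjacency in contrapositive form.\<close>

lemma complete_partite_trans:
  assumes "complete_partite k V E" "x \<in> V" "y \<in> V" "z \<in> V" "{x, y} \<in> E"
  shows "{x, z} \<in> E \<or> {z, y} \<in> E"
proof -
  obtain P where P: "partite_parts k V E P"
    and adj: "\<forall>A\<in>P. \<forall>B\<in>P. A \<noteq> B \<longrightarrow> (\<forall>u\<in>A. \<forall>v\<in>B. {u, v} \<in> E)"
    using assms(1) by (auto simp: complete_partite_def)
  from P have part: "partition_on V P" and indep: "\<forall>A\<in>P. \<forall>u\<in>A. \<forall>v\<in>A. {u, v} \<notin> E"
    by (simp_all add: partite_parts_def)
  obtain A B C where "A \<in> P" "x \<in> A" "B \<in> P" "y \<in> B" "C \<in> P" "z \<in> C"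
    using partition_onD1[OF part] assms(2-4) by auto
  then show ?thesis
    using indep adj assms(5) by metis
qed

text \<open>Two different parts exist and neither is empty. The edge between them ensures that the
  distance 2 is attained in the converse construction.\<close>

lemma complete_partite_edge:
  assumes "complete_partite k V E" "k \<ge> 2"
  obtains a b where "a \<in> V" "b \<in> V" "{a, b} \<in> E"
proof -
  obtain P where part: "partition_on V P" and "finite P" "card P = k"
    and adj: "\<And>A B u v. A \<in> P \<Longrightarrow> B \<in> P \<Longrightarrow> A \<noteq> B \<Longrightarrow> u \<in> A \<Longrightarrow> v \<in> B \<Longrightarrow> {u, v} \<in> E"
    using assms(1) unfolding complete_partite_def partite_parts_def by blast
  then obtain A B where AB: "A \<in> P" "B \<in> P" "A \<noteq> B"
    using assms(2) by (metis card_le_Suc0_iff_eq not_less_eq_eq numeral_2_eq_2)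
  then obtain a b where "a \<in> A" "b \<in> B"
    using partition_onD3[OF part] by fastforce
  then show thesis
    using that[of a b] adj[of A B a b] AB partition_onD1[OF part] by auto
qed

lemma complete_partite_ultrametric:
  fixes E :: "'a set set"
  assumes cp: "complete_partite k V E" and "k \<ge> 2"
  shows "\<exists>\<rho>. Ultrametric_space V \<rho> \<and> E = {p. diametrical_pair \<rho> V p}"
proof -
  define \<rho> :: "'a \<Rightarrow> 'a \<Rightarrow> real"
    where "\<rho> u v = (if u = v then 0 else if {u, v} \<in> E then 2 else 1)" for u v
  have sg: "simple_graph V E"
    using cp by (simp add: complete_partite_def)
  \<comment> \<open>If \<open>\<rho> x y = 2\<close>, one of the other two pairs is an edge, hence
    at distance 2. If \<open>\<rho> x y = 1\<close>, then \<open>z\<close> differs from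
    \<open>x\<close> or from \<open>y\<close>, so the maximum is at least 1.\<close>
  have ultra: "\<rho> x y \<le> max (\<rho> x z) (\<rho> z y)" if "x \<in> V" "y \<in> V" "z \<in> V" for x y z
    using complete_partite_trans[OF cp that] simple_graph_no_loop[OF sg]
    by (auto simp: \<rho>_def)
  interpret Metric_space V \<rho>
  proof
    fix x y z assume "x \<in> V" "y \<in> V" "z \<in> V"
    \<comment> \<open>The maximum of two nonnegative numbers is at most their sum.\<close>
    then show "\<rho> x z \<le> \<rho> x y + \<rho> y z"
      using ultra[of x z y] by (auto simp: \<rho>_def split: if_splits)
  qed (auto simp: \<rho>_def insert_commute)
  interpret Ultrametric_space V \<rho>
    by unfold_locales (rule ultra)
  have edge: "\<rho> u v = 2 \<longleftrightarrow> {u, v} \<in> E" for u v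
    using simple_graph_no_loop[OF sg] by (auto simp: \<rho>_def)
  obtain a b where ab: "a \<in> V" "b \<in> V" "{a, b} \<in> E"
    using complete_partite_edge[OF assms] .
  have "\<rho> x y \<le> 2" for x y
    by (simp add: \<rho>_def)
  then have diam: "mdiam \<rho> V = 2"
    using mdiam_eqI[OF ab(1,2), of \<rho>] edge[of a b] ab(3) by simp
  have "p \<in> E \<longleftrightarrow> diametrical_pair \<rho> V p" for p
  proof
    assume p: "p \<in> E"
    then obtain u v where "p = {u, v}" "u \<noteq> v"
      using sg unfolding simple_graph_def by (metis card_2_iff)
    with p show "diametrical_pair \<rho> V p"
      using sg edge[of u v] by (auto simp: simple_graph_def diametrical_pair_iff diam)
  next
    assume "diametrical_pair \<rho> V p"
    then show "p \<in> E"
      using edge by (auto simp: diametrical_pair_def diam)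
  qed
  then show ?thesis
    using Ultrametric_space_axioms by blast
qed

theorem theorem3p4:
  shows
    "(\<forall>(X :: 'a set) (\<rho> :: 'a \<Rightarrow> 'a \<Rightarrow> real) (E :: 'a set set).
        Ultrametric_space X \<rho> \<and> finite X \<and> 2 \<le> card X \<and> simple_graph X E \<and>
        (\<forall>u\<in>X. \<forall>v\<in>X. u \<noteq> v \<longrightarrow> ({u, v} \<in> E \<longleftrightarrow> diametrical_pair \<rho> X {u, v}))
        \<longrightarrow> (\<exists>k\<ge>2. complete_partite k X E))
     \<and>
     (\<forall>(V :: 'a set) (E :: 'a set set) (k :: nat).
        finite V \<and> k \<ge> 2 \<and> complete_partite k V E
        \<longrightarrow> (\<exists>\<rho> :: 'a \<Rightarrow> 'a \<Rightarrow> real.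
              Ultrametric_space V \<rho> \<and> E = {p. diametrical_pair \<rho> V p}))"
proof (intro conjI allI impI; elim conjE)
  fix X :: "'a set" and \<rho> E
  assume "Ultrametric_space X \<rho>" "finite X" "2 \<le> card X" "simple_graph X E"
    and "\<forall>u\<in>X. \<forall>v\<in>X. u \<noteq> v \<longrightarrow> ({u, v} \<in> E \<longleftrightarrow> diametrical_pair \<rho> X {u, v})"
  then show "\<exists>k\<ge>2. complete_partite k X E"
    by (intro Ultrametric_space.diametrical_graph_complete_partite) auto
qed (rule complete_partite_ultrametric)

end
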